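(* Let $T\subset\mathbb{R}^n$ be a linear subspace, $S\subset T^\perp$ a bounded convex set, and $f:\mathbb{R}^n\to\mathbb{R}$ a smooth convex function. Let $x^0\in T\oplus S$ and assume $D_T<\infty$. Consider the unbounded Frank-Wolfe method (uFW) with initial solution $x^0$, gradient descent step-size $\eta\le 1/L_{f,x^0}^T$, and Frank-Wolfe step-sizes $\alpha_k$ following either the line-search rule or the simple step-size rule. Let $f^*$ be the optimal objective value of $\min\{f(x): x\in T\oplus S\}$. Then for all $k\ge 1$, $$f(x^{k})-f^{*}\le\frac{2C_{f,x^0}^S + 16\, D_T^2/\eta}{k+2}.$$
   Context: Setting: $T\oplus S=\{t+s: t\in T, s\in S\}$; $\mathcal{P}_T$ and $\mathcal{P}_T^\perp$ are the orthogonal projections onto $T$ and $T^\perp$. "Smooth" means differentiable with Lipschitz continuous gradient. uFW algorithm. Input: $x^0\in T\oplus S$, $\eta>0$. For $k=0,1,2,\dots$: (1) $y^k=x^k-\eta\,\mathcal{P}_T\nabla f(x^k)$; (2) $s^k\in\arg\min_{s\in S}\langle\nabla f(y^k),s\rangle$ (any minimizer); (3) $x^{k+1}=y^k+\alpha_k(s^k-\mathcal{P}_T^\perp x^k)$. Step-size rules. Line-search rule: $\alpha_k\in\arg\min_{\alpha\in[0,1]} f(y^k+\alpha(s^k-\mathcal{P}_T^\perp x^k))$. Simple rule: $\alpha_k=\frac{2}{k+2}$ if $f\big(y^k+\frac{2}{k+2}(s^k-\mathcal{P}_T^\perp x^k)\big)\le f(x^0)$, and $\alpha_k=0$ otherwise.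 Constants. $X^0=\{x\in\mathbb{R}^n: f(x)\le f(x^0)\}$. $D_T=\sup_{x,y\in X^0}\|\mathcal{P}_T(x-y)\|_2$. $C_{f,x^0}^S=\sup\big\{\frac{2}{\alpha^2}[f(y)-f(x)-\langle\nabla f(x),y-x\rangle] : s\in S,\ x,y\in\mathbb{R}^n,\ \alpha\in(0,1],\ \mathcal{P}_T^\perp x\in S,\ x\in X^0,\ y=x+\alpha(s-\mathcal{P}_T^\perp x)\big\}$. $L_{f,x^0}^T=\sup\big\{\frac{\|\mathcal{P}_T\nabla f(x)-\mathcal{P}_T\nabla f(y)\|_2}{\|x-y\|_2}: x,y\in T\oplus S,\ x\ne y,\ x-y\in T,\ x,y\in X^0\big\}$. *)

theory Defs
  imports "HOL-Analysis.Analysis"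
begin

definition orth_proj :: "'a::euclidean_space set \<Rightarrow> 'a \<Rightarrow> 'a" where
  "orth_proj T x = (THE p. p \<in> T \<and> x - p \<in> T\<^sup>\<bottom>)"

lemma orth_proj:
  assumes "subspace T"
  shows "orth_proj T x \<in> T" and "x - orth_proj T x \<in> T\<^sup>\<bottom>"
proof -
  have "\<exists>!p. p \<in> T \<and> x - p \<in> T\<^sup>\<bottom>"
  proof (rule ex_ex1I)
    obtain y z where yz: "y \<in> span T" "\<And>w. w \<in> span T \<Longrightarrow> orthogonal z w" "x = y + z"
      using orthogonal_subspace_decomp_exists[of T x] by blast
    have "span T = T"
      using assms by (simp add: span_eq_iff)
    with yz have "y \<in> T \<and> x - y \<in> T\<^sup>\<bottom>"
      by (simp add: orthogonal_comp_def orthogonal_commute)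
    then show "\<exists>p. p \<in> T \<and> x - p \<in> T\<^sup>\<bottom>" ..
  next
    fix p q
    assume "p \<in> T \<and> x - p \<in> T\<^sup>\<bottom>" and "q \<in> T \<and> x - q \<in> T\<^sup>\<bottom>"
    then have "p - q \<in> T" "(x - q) - (x - p) \<in> T\<^sup>\<bottom>"
      using assms by (simp_all only: subspace_diff subspace_orthogonal_comp)
    then have "orthogonal (p - q) (p - q)"
      by (simp add: orthogonal_comp_def)
    then show "p = q"
      by (simp add: orthogonal_self)
  qed
  from theI'[OF this] show "orth_proj T x \<in> T" "x - orth_proj T x \<in> T\<^sup>\<bottom>"
    by (auto simp: orth_proj_def)
qed

definition gradient :: "('a::euclidean_space \<Rightarrow> real) \<Rightarrow> 'a \<Rightarrow> 'a" where
  "gradient f x = (THE D. GDERIV f x :> D)"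

lemma GDERIV_gradient:
  assumes "f differentiable (at x)"
  shows "GDERIV f x :> gradient f x"
proof -
  have "\<exists>!D. GDERIV f x :> D"
  proof (rule ex_ex1I)
    obtain f' where f': "(f has_derivative f') (at x)"
      using assms by (auto simp: differentiable_def)
    have lin: "linear f'"
      using f' by (rule has_derivative_linear)
    have eq: "(\<lambda>h. h \<bullet> adjoint f' 1) = f'"
      by (rule ext) (simp only: adjoint_works[OF lin] inner_real_def mult_1_right)
    have "GDERIV f x :> adjoint f' 1"
      unfolding gderiv_def eq by (rule f')
    then show "\<exists>D. GDERIV f x :> D" ..
  next
    fix D E
    assume "GDERIV f x :> D" and "GDERIV f x :> E"
    then have "(\<lambda>h. h \<bullet> D) = (\<lambda>h. h \<bullet> E)"
      unfolding gderiv_def by (rule has_derivative_unique)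
    then have "h \<bullet> D = h \<bullet> E" for h
      by (rule fun_cong)
    then show "D = E"
      using vector_eq_ldot by blast
  qed
  from theI'[OF this] show ?thesis
    by (simp add: gradient_def)
qed

definition smooth :: "('a::euclidean_space \<Rightarrow> real) \<Rightarrow> bool" where
  "smooth f \<longleftrightarrow> (\<forall>x. f differentiable (at x)) \<and> (\<exists>L. L-lipschitz_on UNIV (gradient f))"

definition sublevel :: "('a \<Rightarrow> real) \<Rightarrow> 'a \<Rightarrow> 'a set" where
  "sublevel f x0 = {x. f x \<le> f x0}"

definition diam_T :: "'a::euclidean_space set \<Rightarrow> ('a \<Rightarrow> real) \<Rightarrow> 'a \<Rightarrow> ereal" where
  "diam_T T f x0 =
     Sup {ereal (norm (orth_proj T (x - y))) | x y. x \<in> sublevel f x0 \<and> y \<in> sublevel f x0}"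

definition curvature_S ::
  "'a::euclidean_space set \<Rightarrow> 'a set \<Rightarrow> ('a \<Rightarrow> real) \<Rightarrow> 'a \<Rightarrow> ereal" where
  "curvature_S T S f x0 =
     Sup {ereal (2 / \<alpha>\<^sup>2 * (f y - f x - gradient f x \<bullet> (y - x))) | s x y \<alpha>.
            s \<in> S \<and> 0 < \<alpha> \<and> \<alpha> \<le> 1 \<and> orth_proj (T\<^sup>\<bottom>) x \<in> S \<and> x \<in> sublevel f x0 \<and>
            y = x + \<alpha> *\<^sub>R (s - orth_proj (T\<^sup>\<bottom>) x)}"

(* The set of quotients is empty in degenerate cases such as T = {0}; inserting 0 makes the
   supremum 0 there, as a supremum taken in [0, \<infinity>], instead of -\<infinity>.  In ereal, 1 / 0 = \<infinity>, so a
   step size bound by 1 / lip_T is then vacuous. *)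
definition lip_T ::
  "'a::euclidean_space set \<Rightarrow> 'a set \<Rightarrow> ('a \<Rightarrow> real) \<Rightarrow> 'a \<Rightarrow> ereal" where
  "lip_T T S f x0 =
     Sup (insert 0
       {ereal (norm (orth_proj T (gradient f x) - orth_proj T (gradient f y)) / norm (x - y)) | x y.
          x \<in> T + S \<and> y \<in> T + S \<and> x \<noteq> y \<and> x - y \<in> T \<and>
          x \<in> sublevel f x0 \<and> y \<in> sublevel f x0})"

definition opt_value :: "'a::euclidean_space set \<Rightarrow> 'a set \<Rightarrow> ('a \<Rightarrow> real) \<Rightarrow> ereal" where
  "opt_value T S f = (INF x\<in>T + S. ereal (f x))"

definition uFW ::
  "'a::euclidean_space set \<Rightarrow> 'a set \<Rightarrow> ('a \<Rightarrow> real) \<Rightarrow> 'a \<Rightarrow> real \<Rightarrow> (nat \<Rightarrow> real) \<Rightarrow>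
   (nat \<Rightarrow> 'a) \<Rightarrow> (nat \<Rightarrow> 'a) \<Rightarrow> (nat \<Rightarrow> 'a) \<Rightarrow> bool" where
  "uFW T S f x0 \<eta> \<alpha> x y s \<longleftrightarrow>
     x 0 = x0 \<and>
     (\<forall>k. y k = x k - \<eta> *\<^sub>R orth_proj T (gradient f (x k)) \<and>
          is_arg_min (\<lambda>v. gradient f (y k) \<bullet> v) (\<lambda>v. v \<in> S) (s k) \<and>
          x (Suc k) = y k + \<alpha> k *\<^sub>R (s k - orth_proj (T\<^sup>\<bottom>) (x k)))"

definition line_search_rule ::
  "'a::euclidean_space set \<Rightarrow> ('a \<Rightarrow> real) \<Rightarrow> (nat \<Rightarrow> real) \<Rightarrow>
   (nat \<Rightarrow> 'a) \<Rightarrow> (nat \<Rightarrow> 'a) \<Rightarrow> (nat \<Rightarrow> 'a) \<Rightarrow> bool" where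
  "line_search_rule T f \<alpha> x y s \<longleftrightarrow>
     (\<forall>k. is_arg_min (\<lambda>a. f (y k + a *\<^sub>R (s k - orth_proj (T\<^sup>\<bottom>) (x k)))) (\<lambda>a. a \<in> {0..1}) (\<alpha> k))"

definition simple_rule ::
  "'a::euclidean_space set \<Rightarrow> ('a \<Rightarrow> real) \<Rightarrow> 'a \<Rightarrow> (nat \<Rightarrow> real) \<Rightarrow>
   (nat \<Rightarrow> 'a) \<Rightarrow> (nat \<Rightarrow> 'a) \<Rightarrow> (nat \<Rightarrow> 'a) \<Rightarrow> bool" where
  "simple_rule T f x0 \<alpha> x y s \<longleftrightarrow>
     (\<forall>k. \<alpha> k =
       (if f (y k + (2 / (real k + 2)) *\<^sub>R (s k - orth_proj (T\<^sup>\<bottom>) (x k))) \<le> f x0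
        then 2 / (real k + 2) else 0))"

end

theory Submission
  imports Defs
begin

text \<open>
  Fix a feasible competitor \<open>u\<close> with \<open>f u \<le> f x0\<close> and follow the gap \<open>f (x k) - f u\<close>
  through one iteration.  Write \<open>D\<close> for the diameter along \<open>T\<close>, \<open>C\<close> for the curvature
  constant, \<open>a = 2 / (k + 2)\<close>, and \<open>G\<close> for the norm of the projected gradient at \<open>x k\<close>.

  The gradient step lowers the gap by \<open>\<eta> / 2 * G\<^sup>2\<close>.  The difficulty is that the Lipschitz
  constant only speaks about the sublevel set, so it must be shown that the step does not
  leave this set; a first-exit argument (\<open>descent_below_level\<close>) does so.

  The Frank-Wolfe step is only optimal in the directions of \<open>T\<^sup>\<bottom>\<close>.  Compared with the classical
  estimate it loses \<open>a * D\<close> times the projected gradient at \<open>y k\<close> (\<open>Frank_Wolfe_step\<close>), which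
  is at most \<open>2 * a * D * G\<close>.  Part of this loss is paid for by the decrease in the gradient step,
  which survives with weight \<open>1 - a\<close>.  When \<open>a\<close> is close to 1 that part is too small, but the
  gradient step joins two points of the sublevel set, so its length \<open>\<eta> * G\<close> is at most \<open>D\<close>.
  Either way the net loss is at most \<open>4 * a\<^sup>2 * D\<^sup>2 / \<eta>\<close> (\<open>gradient_loss_le\<close>), of the same
  order \<open>a\<^sup>2\<close> as the curvature term \<open>a\<^sup>2 * C / 2\<close>.

  The gaps hence satisfy the usual recurrence \<open>h (k + 1) \<le> (1 - a) * h k + a\<^sup>2 * B\<close> with
  \<open>B = C / 2 + 4 * D\<^sup>2 / \<eta>\<close>, which gives \<open>4 * B / (k + 2)\<close> (\<open>rate_of_recurrence\<close>).  Taking the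
  infimum over \<open>u\<close> at the very end avoids any question whether a minimizer exists.
\<close>

section \<open>Orthogonal projections and feasible points\<close>

lemma orth_proj_eqI:
  assumes "subspace T" "p \<in> T" "x - p \<in> T\<^sup>\<bottom>"
  shows "orth_proj T x = p"
proof -
  have "orth_proj T x - p \<in> T" "(x - p) - (x - orth_proj T x) \<in> T\<^sup>\<bottom>"
    using assms orth_proj[OF assms(1), of x]
    by (simp_all only: subspace_diff subspace_orthogonal_comp)
  then have "orthogonal (orth_proj T x - p) (orth_proj T x - p)"
    by (simp add: orthogonal_comp_def)
  then show ?thesis
    by (simp add: orthogonal_self)
qed

lemma orth_proj_diff:
  assumes "subspace T"
  shows "orth_proj T (x - y) = orth_proj T x - orth_proj T y"
proof (rule orth_proj_eqI[OF assms])
  show "orth_proj T x - orth_proj T y \<in> T"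
    using assms by (simp add: orth_proj subspace_diff)
  have "(x - orth_proj T x) - (y - orth_proj T y) \<in> T\<^sup>\<bottom>"
    using assms by (simp only: orth_proj subspace_diff subspace_orthogonal_comp)
  then show "x - y - (orth_proj T x - orth_proj T y) \<in> T\<^sup>\<bottom>"
    by (simp add: algebra_simps)
qed

lemma orth_proj_of_mem:
  assumes "subspace T" "x \<in> T"
  shows "orth_proj T x = x"
  using assms by (intro orth_proj_eqI) (auto simp: subspace_0 subspace_orthogonal_comp)

lemma orth_proj_orthogonal_comp:
  assumes "subspace T"
  shows "orth_proj (T\<^sup>\<bottom>) x = x - orth_proj T x"
  using assms orth_proj[OF assms, of x]
  by (intro orth_proj_eqI) (auto simp: subspace_orthogonal_comp orthogonal_comp_self)

lemma inner_orth_proj: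
  assumes "subspace T" "a \<in> T"
  shows "orth_proj T v \<bullet> a = v \<bullet> a"
proof -
  have "orthogonal a (v - orth_proj T v)"
    using orth_proj(2)[OF assms(1), of v] assms(2) by (simp add: orthogonal_comp_def)
  then show ?thesis
    by (simp add: orthogonal_def inner_diff_right inner_commute)
qed

lemma mem_subspace_plus_iff:
  assumes "subspace T" "S \<subseteq> T\<^sup>\<bottom>"
  shows "x \<in> T + S \<longleftrightarrow> orth_proj (T\<^sup>\<bottom>) x \<in> S"
proof
  assume "x \<in> T + S"
  then obtain t s where ts: "t \<in> T" "s \<in> S" "x = t + s"
    by (auto elim: set_plus_elim)
  then have "orth_proj T x = t"
    using assms by (intro orth_proj_eqI) auto
  with ts show "orth_proj (T\<^sup>\<bottom>) x \<in> S"
    using assms by (simp add: orth_proj_orthogonal_comp)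
next
  assume "orth_proj (T\<^sup>\<bottom>) x \<in> S"
  then have "orth_proj T x + (x - orth_proj T x) \<in> T + S"
    using assms by (intro set_plus_intro) (auto simp: orth_proj orth_proj_orthogonal_comp)
  then show "x \<in> T + S"
    by simp
qed

section \<open>First-order facts about smooth convex functions\<close>

lemma DERIV_along_line:
  assumes "smooth f"
  shows "((\<lambda>t. f (x + t *\<^sub>R d)) has_real_derivative gradient f (x + t *\<^sub>R d) \<bullet> d) (at t)"
proof -
  have "GDERIV f (x + t *\<^sub>R d) :> gradient f (x + t *\<^sub>R d)"
    using assms by (intro GDERIV_gradient) (auto simp: smooth_def)
  then have f': "(f has_derivative (\<lambda>h. h \<bullet> gradient f (x + t *\<^sub>R d))) (at (x + t *\<^sub>R d))"
    by (simp add: gderiv_def)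
  have "((\<lambda>t. x + t *\<^sub>R d) has_derivative (\<lambda>h. h *\<^sub>R d)) (at t)"
    by (auto intro!: derivative_eq_intros)
  from has_derivative_compose[OF this f'] show ?thesis
    by (simp add: has_field_derivative_def inner_commute mult.commute[of _ "d \<bullet> _"])
qed

lemma convex_above_tangent:
  assumes "smooth f" "convex_on UNIV f"
  shows "f z + gradient f z \<bullet> (u - z) \<le> f u"
proof -
  have "convex_on UNIV (\<lambda>t::real. f (z + t *\<^sub>R (u - z)))"
  proof (rule convex_onI)
    fix t a b :: real
    assume "0 < t" "t < 1"
    moreover have "z + ((1 - t) *\<^sub>R a + t *\<^sub>R b) *\<^sub>R (u - z) =
        (1 - t) *\<^sub>R (z + a *\<^sub>R (u - z)) + t *\<^sub>R (z + b *\<^sub>R (u - z))"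
      by (simp add: algebra_simps)
    ultimately show "f (z + ((1 - t) *\<^sub>R a + t *\<^sub>R b) *\<^sub>R (u - z)) \<le>
        (1 - t) * f (z + a *\<^sub>R (u - z)) + t * f (z + b *\<^sub>R (u - z))"
      using convex_onD[OF assms(2)] by simp
  qed simp
  from convex_on_imp_above_tangent[OF this, of 0 1, OF _ _ _
      DERIV_along_line[OF assms(1), of z "u - z" 0]]
  show ?thesis
    by simp
qed

section \<open>The gradient step\<close>

text \<open>The differential inequality is only known at times where \<open>\<phi>\<close> has not exceeded \<open>c\<close>,
  so staying below \<open>c\<close> and decreasing have to be established together: at a first exit
  time \<open>b < r\<close> the slope \<open>- A (1 - l b)\<close> would still be strictly negative, which
  keeps \<open>\<phi>\<close> below \<open>c\<close> for a while longer.\<close>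

lemma descent_below_level:
  fixes \<phi> \<phi>' :: "real \<Rightarrow> real"
  assumes deriv: "\<And>t. (\<phi> has_real_derivative \<phi>' t) (at t)"
    and start: "\<phi> 0 \<le> c"
    and slope: "\<And>t. 0 \<le> t \<Longrightarrow> t \<le> r \<Longrightarrow> \<phi> t \<le> c \<Longrightarrow> \<phi>' t \<le> - A * (1 - l * t)"
    and "0 < A" "0 \<le> l" "0 < r" "r * l \<le> 1"
  shows "\<phi> r \<le> c" and "\<phi> r \<le> \<phi> 0 - r / 2 * A"
proof -
  have below: "\<phi> t \<le> c" if "0 \<le> t" "t \<le> r" for t
  proof (rule ccontr)
    assume "\<not> \<phi> t \<le> c"
    define B where "B = {t \<in> {0..r}. c < \<phi> t}"
    \<comment> \<open>the first exit time\<close>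
    define b where "b = Inf B"
    have B: "t \<in> B" "bdd_below B"
      using that \<open>\<not> \<phi> t \<le> c\<close> by (auto simp: B_def intro: bdd_belowI[of _ 0])
    then have "0 \<le> b" "b \<le> t"
      unfolding b_def by (auto simp: B_def intro: cInf_greatest cInf_lower)
    have before: "\<phi> t \<le> c" if "0 \<le> t" "t < b" for t
      using that cInf_lower[OF _ B(2), of t] \<open>b \<le> _\<close> \<open>_ \<le> r\<close> by (force simp: B_def b_def)
    have "\<phi> b \<le> c"
    proof (rule ccontr)
      assume above: "\<not> \<phi> b \<le> c"
      then have "0 < b"
        using start \<open>0 \<le> b\<close> by (cases "b = 0") auto
      have "(\<phi> \<longlongrightarrow> \<phi> b) (at_left b)"
        using DERIV_isCont[OF deriv] by (auto simp: isCont_def intro: filterlim_at_split[THEN iffD1, THEN conjunct1])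
      moreover have "eventually (\<lambda>t. \<phi> t \<le> c) (at_left b)"
        using eventually_at_left_real[OF \<open>0 < b\<close>] by eventually_elim (auto intro: before)
      ultimately have "\<phi> b \<le> c"
        by (rule tendsto_upperbound) simp
      with above show False ..
    qed
    have "b < t"
      using \<open>\<phi> b \<le> c\<close> \<open>\<not> \<phi> t \<le> c\<close> \<open>b \<le> t\<close> by (cases "b = t") auto
    have "l * b < 1"
    proof (cases "l = 0")
      case False
      then have "l * b < l * r"
        using \<open>b < t\<close> \<open>t \<le> r\<close> \<open>0 \<le> l\<close> by simp
      then show ?thesis
        using \<open>r * l \<le> 1\<close> by (simp add: mult.commute)
    qed simp
    have "- A * (1 - l * b) < 0"
      using \<open>0 < A\<close> \<open>l * b < 1\<close> by simp
    with slope[of b] have "\<phi>' b < 0"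
      using \<open>\<phi> b \<le> c\<close> \<open>0 \<le> b\<close> \<open>b \<le> t\<close> \<open>t \<le> r\<close> by linarith
    then obtain e where e: "0 < e" "\<And>h. 0 < h \<Longrightarrow> h < e \<Longrightarrow> \<phi> (b + h) < \<phi> b"
      using DERIV_neg_dec_right[OF deriv] by blast
    obtain t' where t': "t' \<in> B" "t' < b + e"
      using cInf_lessD[of B "b + e"] B(1) e(1) by (auto simp: b_def)
    moreover have "b \<le> t'"
      using cInf_lower[OF t'(1) B(2)] by (simp add: b_def)
    ultimately have "\<phi> t' \<le> \<phi> b"
      using e(2)[of "t' - b"] by (cases "t' = b") auto
    with \<open>\<phi> b \<le> c\<close> t'(1) show False
      by (simp add: B_def)
  qed
  then show "\<phi> r \<le> c"
    using \<open>0 < r\<close> by simp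
  \<comment> \<open>Integrating the slope gives the decrease \<open>A * (r - l * r\<^sup>2 / 2)\<close>.\<close>
  define \<psi> where "\<psi> t = \<phi> t + A * (t - l * t\<^sup>2 / 2)" for t
  have "\<psi> r \<le> \<psi> 0"
  proof (rule DERIV_nonpos_imp_nonincreasing[of 0 r \<psi>])
    fix t
    assume t: "0 \<le> t" "t \<le> r"
    have "(\<psi> has_real_derivative \<phi>' t + A * (1 - l * t)) (at t)"
      unfolding \<psi>_def by (auto intro!: derivative_eq_intros deriv)
    moreover have "\<phi>' t + A * (1 - l * t) \<le> 0"
      using slope[OF t below[OF t]] by simp
    ultimately show "\<exists>y. (\<psi> has_real_derivative y) (at t) \<and> y \<le> 0"
      by blast
  qed (use \<open>0 < r\<close> in simp)
  moreover have "A * (r - l * r\<^sup>2 / 2) \<ge> r / 2 * A"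
  proof -
    have "A * r * (r * l) \<le> A * r * 1"
      using \<open>0 < A\<close> \<open>0 < r\<close> \<open>r * l \<le> 1\<close> by (intro mult_left_mono) auto
    then show ?thesis
      by (simp add: field_simps power2_eq_square)
  qed
  ultimately show "\<phi> r \<le> \<phi> 0 - r / 2 * A"
    by (simp add: \<psi>_def)
qed

lemma lip_T_bound:
  assumes "0 < \<eta>" "ereal \<eta> \<le> 1 / lip_T T S f x0"
  obtains l where "0 \<le> l" "\<eta> * l \<le> 1"
    "\<And>x z. x \<in> T + S \<Longrightarrow> z \<in> T + S \<Longrightarrow> x - z \<in> T \<Longrightarrow>
       x \<in> sublevel f x0 \<Longrightarrow> z \<in> sublevel f x0 \<Longrightarrow>
       norm (orth_proj T (gradient f x) - orth_proj T (gradient f z)) \<le> l * norm (x - z)"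
proof -
  have nonneg: "0 \<le> lip_T T S f x0"
    unfolding lip_T_def by (rule Sup_upper) simp
  moreover have "lip_T T S f x0 \<noteq> \<infinity>"
    using assms by auto
  ultimately obtain l where l: "lip_T T S f x0 = ereal l"
    by (cases "lip_T T S f x0") auto
  show thesis
  proof
    show "0 \<le> l"
      using nonneg l by simp
    \<comment> \<open>For \<open>l = 0\<close> the bound on \<open>\<eta>\<close> is \<open>1 / 0 = \<infinity>\<close> and carries no information.\<close>
    then show "\<eta> * l \<le> 1"
      using assms l by (cases "l = 0") (auto simp: one_ereal_def field_simps)
    fix x z
    assume xz: "x \<in> T + S" "z \<in> T + S" "x - z \<in> T" "x \<in> sublevel f x0" "z \<in> sublevel f x0"
    show "norm (orth_proj T (gradient f x) - orth_proj T (gradient f z)) \<le> l * norm (x - z)"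
    proof (cases "x = z")
      case False
      have "ereal (norm (orth_proj T (gradient f x) - orth_proj T (gradient f z)) / norm (x - z))
          \<le> lip_T T S f x0"
        unfolding lip_T_def using xz False by (intro Sup_upper) blast
      then show ?thesis
        using False l by (simp add: pos_divide_le_eq)
    qed simp
  qed
qed

lemma norm_orth_proj_le_diam_T:
  assumes "diam_T T f x0 = ereal D" "x \<in> sublevel f x0" "z \<in> sublevel f x0"
  shows "norm (orth_proj T (x - z)) \<le> D"
proof -
  have "ereal (norm (orth_proj T (x - z))) \<le> diam_T T f x0"
    unfolding diam_T_def using assms(2,3) by (intro Sup_upper) blast
  then show ?thesis
    using assms(1) by simp
qed

text \<open>Steps along \<open>T\<close> change neither the \<open>T\<^sup>\<bottom>\<close>-component nor feasibility, so the
  restricted Lipschitz constant applies along the whole gradient step as long as it has not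
  left the sublevel set.  Besides the usual decrease, the step comes with two bounds on
  projected gradients: its length is at most \<open>D\<close> because both of its ends are in the
  sublevel set, and the gradient at its end is at most twice the one at its start because
  \<open>l * (\<eta> * norm g) \<le> norm g\<close>.\<close>

lemma gradient_step:
  fixes f :: "'a::euclidean_space \<Rightarrow> real"
  assumes "subspace T" "S \<subseteq> T\<^sup>\<bottom>" "smooth f"
    and "0 < \<eta>" "ereal \<eta> \<le> 1 / lip_T T S f x0" "diam_T T f x0 = ereal D"
    and x: "x \<in> T + S" "x \<in> sublevel f x0"
  defines "g \<equiv> orth_proj T (gradient f x)"
  defines "y \<equiv> x - \<eta> *\<^sub>R g"
  shows "orth_proj (T\<^sup>\<bottom>) y = orth_proj (T\<^sup>\<bottom>) x"
    and "y \<in> sublevel f x0"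
    and "f y \<le> f x - \<eta> / 2 * (norm g)\<^sup>2"
    and "norm (orth_proj T (gradient f y)) \<le> 2 * norm g"
    and "\<eta> * norm g \<le> D"
proof -
  obtain l where l: "0 \<le> l" "\<eta> * l \<le> 1" and
    lip: "\<And>x z. x \<in> T + S \<Longrightarrow> z \<in> T + S \<Longrightarrow> x - z \<in> T \<Longrightarrow>
       x \<in> sublevel f x0 \<Longrightarrow> z \<in> sublevel f x0 \<Longrightarrow>
       norm (orth_proj T (gradient f x) - orth_proj T (gradient f z)) \<le> l * norm (x - z)"
    using lip_T_bound[OF assms(4,5)] by blast
  have g: "g \<in> T"
    unfolding g_def using assms(1) by (rule orth_proj)
  have tg: "t *\<^sub>R g \<in> T" for t
    using assms(1) g by (rule subspace_scale)
  define z where "z t = x + t *\<^sub>R (- g)" for t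
  have perp: "orth_proj (T\<^sup>\<bottom>) (z t) = orth_proj (T\<^sup>\<bottom>) x" for t
    using assms(1) tg[of t] orth_proj_diff[OF assms(1), of x "t *\<^sub>R g"]
    by (simp add: z_def orth_proj_orthogonal_comp orth_proj_of_mem)
  then have feasible: "z t \<in> T + S" for t
    using x(1) assms(1,2) by (simp add: mem_subspace_plus_iff)
  have y: "y = z \<eta>"
    by (simp add: y_def z_def)
  have grad: "norm (g - orth_proj T (gradient f (z t))) \<le> l * (t * norm g)"
    if "0 \<le> t" "z t \<in> sublevel f x0" for t
    using lip[OF x(1) feasible _ x(2) that(2)] that(1) tg[of t] by (simp add: z_def g_def)
  show "orth_proj (T\<^sup>\<bottom>) y = orth_proj (T\<^sup>\<bottom>) x"
    by (simp add: y perp)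
  have descent: "f y \<le> f x0 \<and> f y \<le> f x - \<eta> / 2 * (norm g)\<^sup>2"
  proof (cases "g = 0")
    case True
    then show ?thesis
      using x(2) by (simp add: y_def sublevel_def)
  next
    case False
    let ?\<phi> = "\<lambda>t. f (x + t *\<^sub>R (- g))" and ?\<phi>' = "\<lambda>t. gradient f (x + t *\<^sub>R (- g)) \<bullet> (- g)"
    have slope: "?\<phi>' t \<le> - (norm g)\<^sup>2 * (1 - l * t)" if "0 \<le> t" "?\<phi> t \<le> f x0" for t
    proof -
      let ?gt = "orth_proj T (gradient f (z t))"
      have "(g - ?gt) \<bullet> g \<le> norm (g - ?gt) * norm g"
        by (rule norm_cauchy_schwarz)
      also have "\<dots> \<le> l * (t * norm g) * norm g"
        using that by (intro mult_right_mono grad) (simp_all add: sublevel_def z_def)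
      finally have "(norm g)\<^sup>2 - ?gt \<bullet> g \<le> l * t * (norm g)\<^sup>2"
        by (simp add: inner_diff_left power2_norm_eq_inner[symmetric] power2_eq_square mult.assoc)
      then show ?thesis
        by (simp add: inner_orth_proj[OF assms(1) g] z_def algebra_simps)
    qed
    have "?\<phi> \<eta> \<le> f x0" "?\<phi> \<eta> \<le> ?\<phi> 0 - \<eta> / 2 * (norm g)\<^sup>2"
      using descent_below_level[where \<phi> = ?\<phi> and c = "f x0" and A = "(norm g)\<^sup>2",
          OF DERIV_along_line[OF assms(3)] _ slope _ l(1) assms(4) l(2)] False x(2)
      by (simp_all add: sublevel_def)
    then show ?thesis
      by (simp add: y z_def)
  qed
  then show in_sub: "y \<in> sublevel f x0" and "f y \<le> f x - \<eta> / 2 * (norm g)\<^sup>2"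
    by (simp_all add: sublevel_def)
  have "l * (\<eta> * norm g) \<le> 1 * norm g"
    unfolding mult.assoc[symmetric] using l(2) by (intro mult_right_mono) (simp_all add: mult.commute)
  then have "norm (g - orth_proj T (gradient f y)) \<le> norm g"
    using grad[of \<eta>] in_sub assms(4) by (simp add: y)
  then show "norm (orth_proj T (gradient f y)) \<le> 2 * norm g"
    using norm_triangle_sub[of "orth_proj T (gradient f y)" g] by (simp add: norm_minus_commute)
  have "norm (orth_proj T (x - y)) \<le> D"
    using assms(6) x(2) in_sub by (rule norm_orth_proj_le_diam_T)
  then show "\<eta> * norm g \<le> D"
    using assms(1,4) tg[of \<eta>] by (simp add: y_def orth_proj_of_mem)
qed

section \<open>The Frank-Wolfe step\<close>

lemma curvature_S_bound:
  assumes "curvature_S T S f x0 = ereal C"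
    and "z \<in> sublevel f x0" "orth_proj (T\<^sup>\<bottom>) z \<in> S" "v \<in> S" "0 < a" "a \<le> 1"
  shows "f (z + a *\<^sub>R (v - orth_proj (T\<^sup>\<bottom>) z)) \<le>
      f z + a * (gradient f z \<bullet> (v - orth_proj (T\<^sup>\<bottom>) z)) + a\<^sup>2 * C / 2"
proof -
  let ?w = "z + a *\<^sub>R (v - orth_proj (T\<^sup>\<bottom>) z)"
  have "ereal (2 / a\<^sup>2 * (f ?w - f z - gradient f z \<bullet> (?w - z))) \<le> curvature_S T S f x0"
    unfolding curvature_S_def using assms(2-) by (intro Sup_upper) blast
  then have "2 / a\<^sup>2 * (f ?w - f z - a * (gradient f z \<bullet> (v - orth_proj (T\<^sup>\<bottom>) z))) \<le> C"
    using assms(1) by simp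
  then show ?thesis
    using assms(5) by (simp add: pos_divide_le_eq mult.commute[of C])
qed

text \<open>The degenerate choice \<open>s = orth_proj (T\<^sup>\<bottom>) x0\<close>, \<open>x = y = x0\<close> contributes the value 0 to
  the supremum.\<close>

lemma curvature_S_nonneg:
  assumes "orth_proj (T\<^sup>\<bottom>) x0 \<in> S"
  shows "0 \<le> curvature_S T S f x0"
proof -
  have "ereal (2 / 1\<^sup>2 * (f x0 - f x0 - gradient f x0 \<bullet> (x0 - x0))) \<le> curvature_S T S f x0"
    unfolding curvature_S_def using assms
    by (intro Sup_upper CollectI exI[of _ "orth_proj (T\<^sup>\<bottom>) x0"] exI[of _ x0] exI[of _ "1::real"])
      (simp add: sublevel_def)
  then show ?thesis
    by (simp add: zero_ereal_def)
qed

text \<open>Convexity splits the gap \<open>f u - f z\<close> into a \<open>T\<^sup>\<bottom>\<close>-part, which the linear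
  minimization over \<open>S\<close> controls exactly as in the classical method, and a \<open>T\<close>-part,
  which is at most \<open>D\<close> times the projected gradient.\<close>

lemma Frank_Wolfe_step:
  fixes f :: "'a::euclidean_space \<Rightarrow> real"
  assumes "subspace T" "S \<subseteq> T\<^sup>\<bottom>" "smooth f" "convex_on UNIV f"
    and "diam_T T f x0 = ereal D" "curvature_S T S f x0 = ereal C"
    and z: "z \<in> sublevel f x0" "orth_proj (T\<^sup>\<bottom>) z \<in> S"
    and u: "u \<in> sublevel f x0" "u \<in> T + S"
    and v: "is_arg_min (\<lambda>v. gradient f z \<bullet> v) (\<lambda>v. v \<in> S) v"
    and a: "0 < a" "a \<le> 1"
  shows "f (z + a *\<^sub>R (v - orth_proj (T\<^sup>\<bottom>) z)) - f u \<le>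
      (1 - a) * (f z - f u) + a * D * norm (orth_proj T (gradient f z)) + a\<^sup>2 * C / 2"
proof -
  let ?Q = "orth_proj (T\<^sup>\<bottom>)" and ?G = "orth_proj T (gradient f z)"
  have "?Q u \<in> S"
    using u(2) assms(1,2) by (simp add: mem_subspace_plus_iff)
  then have "gradient f z \<bullet> (v - ?Q z) \<le> gradient f z \<bullet> (?Q u - ?Q z)"
    using v by (auto simp: is_arg_min_def inner_diff_right not_less)
  also have "?Q u - ?Q z = (u - z) + orth_proj T (z - u)"
    using assms(1) by (simp add: orth_proj_orthogonal_comp orth_proj_diff)
  also have "gradient f z \<bullet> \<dots> = gradient f z \<bullet> (u - z) + ?G \<bullet> orth_proj T (z - u)"
    using assms(1) by (simp add: inner_add_right inner_orth_proj orth_proj)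
  also have "\<dots> \<le> (f u - f z) + norm ?G * D"
  proof (rule add_mono)
    show "gradient f z \<bullet> (u - z) \<le> f u - f z"
      using convex_above_tangent[OF assms(3,4), of z u] by simp
    have "?G \<bullet> orth_proj T (z - u) \<le> norm ?G * norm (orth_proj T (z - u))"
      by (rule norm_cauchy_schwarz)
    also have "\<dots> \<le> norm ?G * D"
      using norm_orth_proj_le_diam_T[OF assms(5) z(1) u(1)] by (simp add: mult_left_mono)
    finally show "?G \<bullet> orth_proj T (z - u) \<le> norm ?G * D" .
  qed
  finally have "a * (gradient f z \<bullet> (v - ?Q z)) \<le> a * ((f u - f z) + norm ?G * D)"
    using a(1) by (simp add: mult_left_mono)
  moreover have "v \<in> S"
    using v by (simp add: is_arg_min_def)
  ultimately show ?thesis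
    using curvature_S_bound[OF assms(6) z \<open>v \<in> S\<close> a] by (simp add: algebra_simps)
qed

section \<open>The rate of convergence\<close>

text \<open>The loss \<open>2 a D G\<close> caused by the nonzero projected gradient against the gain of the
  gradient step.  For small \<open>a\<close> the gain carries at least half of its weight, and completing
  the square suffices.  For large \<open>a\<close> (in particular \<open>a = 1\<close>, where the gain vanishes)
  the a priori bound \<open>\<eta> G \<le> D\<close> takes over.\<close>

lemma gradient_loss_le:
  fixes a D G \<eta> :: real
  assumes "0 \<le> a" "a \<le> 1" "0 \<le> G" "\<eta> * G \<le> D" "0 < \<eta>"
  shows "2 * a * D * G - (1 - a) * (\<eta> / 2 * G\<^sup>2) \<le> 4 * a\<^sup>2 * D\<^sup>2 / \<eta>"
proof -
  have "0 \<le> D"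
    using assms(3-5) by (meson mult_nonneg_nonneg less_imp_le order_trans)
  show ?thesis
  proof (cases "a \<le> 1 / 2")
    case True
    have "(1 / 2) * (\<eta> / 2 * G\<^sup>2) \<le> (1 - a) * (\<eta> / 2 * G\<^sup>2)"
      using True assms(5) by (intro mult_right_mono) auto
    moreover have "0 \<le> (4 * a * D - \<eta> * G)\<^sup>2 / (4 * \<eta>)"
      using assms(5) by simp
    then have "2 * a * D * G - (1 / 2) * (\<eta> / 2 * G\<^sup>2) \<le> 4 * a\<^sup>2 * D\<^sup>2 / \<eta>"
      using assms(5) by (simp add: field_simps power2_eq_square)
    ultimately show ?thesis
      by linarith
  next
    case False
    have "G \<le> D / \<eta>"
      using assms(4,5) by (simp add: field_simps)
    then have "2 * a * D * G \<le> 2 * a * D * (D / \<eta>)"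
      using assms(1) \<open>0 \<le> D\<close> by (intro mult_left_mono) auto
    also have "\<dots> = 2 * a * (D\<^sup>2 / \<eta>)"
      by (simp add: power2_eq_square)
    also have "\<dots> \<le> 4 * a\<^sup>2 * (D\<^sup>2 / \<eta>)"
      using False assms(1,5) by (intro mult_right_mono) (simp_all add: power2_eq_square)
    finally have "2 * a * D * G \<le> 4 * a\<^sup>2 * D\<^sup>2 / \<eta>"
      by simp
    moreover have "0 \<le> (1 - a) * (\<eta> / 2 * G\<^sup>2)"
      using assms(2,5) by (intro mult_nonneg_nonneg) auto
    ultimately show ?thesis
      by linarith
  qed
qed

text \<open>For \<open>k = 0\<close> the factor \<open>1 - 2 / (k + 2)\<close> vanishes, so the first step already forgets
  the initial gap, and the rate holds from index 1 on.
  Afterwards it is preserved because \<open>(n + 1) * (n + 3) \<le> (n + 2)\<^sup>2\<close>.\<close>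

lemma rate_of_recurrence:
  fixes h :: "nat \<Rightarrow> real"
  assumes step: "\<And>k. h (Suc k) \<le> (1 - 2 / (real k + 2)) * h k + (2 / (real k + 2))\<^sup>2 * B"
    and "0 \<le> B"
  shows "h (Suc k) \<le> 4 * B / (real (Suc k) + 2)"
proof (induction k)
  case 0
  have "h (Suc 0) \<le> B"
    using step[of 0] by simp
  then show ?case
    using assms(2) by simp
next
  case (Suc k)
  let ?n = "real (Suc k)"
  have "h (Suc (Suc k)) \<le> (1 - 2 / (?n + 2)) * h (Suc k) + (2 / (?n + 2))\<^sup>2 * B"
    by (rule step)
  also have "\<dots> \<le> (1 - 2 / (?n + 2)) * (4 * B / (?n + 2)) + (2 / (?n + 2))\<^sup>2 * B"
    using Suc.IH by (intro add_right_mono mult_left_mono) (simp_all add: field_simps)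
  also have "\<dots> = 4 * B * ((?n + 1) / (?n + 2)\<^sup>2)"
    by (simp add: divide_simps power2_eq_square) (simp add: algebra_simps)
  finally have bound: "h (Suc (Suc k)) \<le> 4 * B * ((?n + 1) / (?n + 2)\<^sup>2)" .
  have "(?n + 1) * (?n + 3) \<le> (?n + 2)\<^sup>2"
    by (simp add: power2_eq_square algebra_simps)
  then have "(?n + 1) / (?n + 2)\<^sup>2 \<le> 1 / (?n + 3)"
    by (simp add: pos_divide_le_eq pos_le_divide_eq)
  then have "4 * B * ((?n + 1) / (?n + 2)\<^sup>2) \<le> 4 * B * (1 / (?n + 3))"
    using assms(2) by (intro mult_left_mono) auto
  with bound show ?case
    by (simp add: add.commute)
qed

text \<open>Both rules make \<open>x (Suc k)\<close> at least as good as the trial point with step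
  \<open>2 / (k + 2)\<close> and keep it in the sublevel set.  A rejected trial of the simple rule
  is no exception: its value exceeds \<open>f x0\<close>, while the iterate \<open>y k\<close> taken instead
  stays below.\<close>

lemma step_size_rules:
  assumes "line_search_rule T f \<alpha> x y s \<or> simple_rule T f x0 \<alpha> x y s"
    and "x (Suc k) = y k + \<alpha> k *\<^sub>R (s k - orth_proj (T\<^sup>\<bottom>) (x k))"
    and "f (y k) \<le> f x0"
  shows "0 \<le> \<alpha> k" "\<alpha> k \<le> 1" "f (x (Suc k)) \<le> f x0"
    and "f (x (Suc k)) \<le> f (y k + (2 / (real k + 2)) *\<^sub>R (s k - orth_proj (T\<^sup>\<bottom>) (x k)))"
proof -
  let ?p = "\<lambda>a. f (y k + a *\<^sub>R (s k - orth_proj (T\<^sup>\<bottom>) (x k)))" and ?a = "2 / (real k + 2)"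
  have a: "0 \<le> ?a" "?a \<le> 1"
    by auto
  have "0 \<le> \<alpha> k \<and> \<alpha> k \<le> 1 \<and> f (x (Suc k)) \<le> f x0 \<and> f (x (Suc k)) \<le> ?p ?a"
    using assms(1)
  proof
    assume "line_search_rule T f \<alpha> x y s"
    then have \<alpha>: "\<alpha> k \<in> {0..1}" "\<And>a. a \<in> {0..1} \<Longrightarrow> ?p (\<alpha> k) \<le> ?p a"
      unfolding line_search_rule_def is_arg_min_def by (force simp: not_less)+
    have "?p (\<alpha> k) \<le> f (y k)" "?p (\<alpha> k) \<le> ?p ?a"
      using \<alpha>(2)[of 0] \<alpha>(2)[of ?a] a by auto
    with \<alpha>(1) assms(2,3) show ?thesis
      by auto
  next
    assume "simple_rule T f x0 \<alpha> x y s"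
    then have "\<alpha> k = (if ?p ?a \<le> f x0 then ?a else 0)"
      by (simp add: simple_rule_def)
    with a assms(2,3) show ?thesis
      by (auto split: if_splits)
  qed
  then show "0 \<le> \<alpha> k" "\<alpha> k \<le> 1" "f (x (Suc k)) \<le> f x0" "f (x (Suc k)) \<le> ?p ?a"
    by auto
qed

theorem theorem3p1:
  fixes T S :: "(real ^ 'n) set" and f :: "real ^ 'n \<Rightarrow> real" and x0 :: "real ^ 'n"
    and \<eta> :: real and \<alpha> :: "nat \<Rightarrow> real" and x y s :: "nat \<Rightarrow> real ^ 'n"
  assumes "subspace T"
    and "S \<subseteq> T\<^sup>\<bottom>" and "bounded S" and "convex S"
    and "smooth f" and "convex_on UNIV f"
    and "x0 \<in> T + S"
    and "diam_T T f x0 < \<infinity>"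
    and "0 < \<eta>" and "ereal \<eta> \<le> 1 / lip_T T S f x0"
    and "uFW T S f x0 \<eta> \<alpha> x y s"
    and "line_search_rule T f \<alpha> x y s \<or> simple_rule T f x0 \<alpha> x y s"
  shows "\<forall>k\<ge>1. ereal (f (x k)) - opt_value T S f \<le>
           (2 * curvature_S T S f x0 + 16 * (diam_T T f x0)\<^sup>2 / ereal \<eta>) / ereal (real k + 2)"
proof -
  let ?Q = "orth_proj (T\<^sup>\<bottom>)"
  have init: "x 0 = x0"
    and y: "\<And>k. y k = x k - \<eta> *\<^sub>R orth_proj T (gradient f (x k))"
    and s: "\<And>k. is_arg_min (\<lambda>v. gradient f (y k) \<bullet> v) (\<lambda>v. v \<in> S) (s k)"
    and x_Suc: "\<And>k. x (Suc k) = y k + \<alpha> k *\<^sub>R (s k - ?Q (x k))"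
    using assms(11) unfolding uFW_def by blast+
  have "ereal (norm (orth_proj T (x0 - x0))) \<le> diam_T T f x0"
    unfolding diam_T_def
    by (intro Sup_upper CollectI exI[of _ x0]) (simp add: sublevel_def)
  then obtain D where D: "diam_T T f x0 = ereal D"
    using assms(8) by (cases "diam_T T f x0") auto
  have C_nonneg: "0 \<le> curvature_S T S f x0"
    using assms(1,2,7) by (intro curvature_S_nonneg) (simp_all add: mem_subspace_plus_iff)
  note grad_step = gradient_step[OF assms(1,2,5,9,10) D, where x = "x k" for k, folded y]
  have iterates: "x k \<in> T + S \<and> x k \<in> sublevel f x0" for k
  proof (induction k)
    case 0
    then show ?case
      using assms(7) by (simp add: init sublevel_def)
  next
    case (Suc k)
    then have xk: "x k \<in> T + S" "x k \<in> sublevel f x0"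
      by auto
    have "f (y k) \<le> f x0"
      using grad_step(2)[OF xk] by (simp add: sublevel_def)
    note rules = step_size_rules[OF assms(12) x_Suc this]
    have Qx: "?Q (x k) \<in> S" and sk: "s k \<in> S"
      using xk(1) assms(1,2) s[of k] by (simp_all add: mem_subspace_plus_iff is_arg_min_def)
    let ?w = "?Q (x k) + \<alpha> k *\<^sub>R (s k - ?Q (x k))"
    have "(1 - \<alpha> k) *\<^sub>R ?Q (x k) + \<alpha> k *\<^sub>R s k \<in> S"
      using rules(1,2) Qx sk \<open>convex S\<close> by (intro convexD) auto
    then have "?w \<in> S"
      by (simp add: algebra_simps)
    moreover have "x (Suc k) = orth_proj T (y k) + ?w"
      using orth_proj_orthogonal_comp[OF assms(1), of "y k"] grad_step(1)[OF xk] by (simp add: x_Suc)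
    ultimately have "x (Suc k) \<in> T + S"
      using orth_proj(1)[OF assms(1), of "y k"] by (auto intro: set_plus_intro)
    then show ?case
      using rules(3) by (simp add: sublevel_def)
  qed
  \<comment> \<open>An infinite curvature constant makes the right-hand side infinite.\<close>
  show ?thesis
  proof (cases "curvature_S T S f x0 = \<infinity>")
    case True
    then show ?thesis
      using assms(9) D by simp
  next
    case False
    then obtain C where C: "curvature_S T S f x0 = ereal C" "0 \<le> C"
      using C_nonneg by (cases "curvature_S T S f x0") auto
    define B where "B = C / 2 + 4 * D\<^sup>2 / \<eta>"
    have "0 \<le> B"
      using C(2) assms(9) by (simp add: B_def)
    have step: "f (x (Suc k)) - f u \<le>
        (1 - 2 / (real k + 2)) * (f (x k) - f u) + (2 / (real k + 2))\<^sup>2 * B"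
      if u: "u \<in> sublevel f x0" "u \<in> T + S" for u k
    proof -
      define a where "a = 2 / (real k + 2)"
      define G where "G = norm (orth_proj T (gradient f (x k)))"
      have a: "0 < a" "a \<le> 1"
        by (auto simp: a_def)
      note xk = iterates[of k, THEN conjunct1] iterates[of k, THEN conjunct2]
      note gs = grad_step[OF xk, folded G_def]
      have yk: "?Q (y k) \<in> S"
        using xk(1) assms(1,2) gs(1) by (simp add: mem_subspace_plus_iff)
      have "0 \<le> D"
        using norm_orth_proj_le_diam_T[OF D xk(2) xk(2)] norm_ge_zero order_trans by blast
      have "f (x (Suc k)) - f u \<le> f (y k + a *\<^sub>R (s k - ?Q (y k))) - f u"
        using step_size_rules(4)[OF assms(12) x_Suc] gs(1,2) by (simp add: a_def sublevel_def)
      also have "\<dots> \<le> (1 - a) * (f (y k) - f u) +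
          a * D * norm (orth_proj T (gradient f (y k))) + a\<^sup>2 * C / 2"
        by (rule Frank_Wolfe_step[OF assms(1,2,5,6) D C(1) gs(2) yk u s a])
      also have "\<dots> \<le> (1 - a) * (f (x k) - \<eta> / 2 * G\<^sup>2 - f u) + a * D * (2 * G) + a\<^sup>2 * C / 2"
        using a gs(3,4) \<open>0 \<le> D\<close> by (intro add_mono mult_left_mono) auto
      also have "\<dots> = (1 - a) * (f (x k) - f u) +
          (2 * a * D * G - (1 - a) * (\<eta> / 2 * G\<^sup>2)) + a\<^sup>2 * C / 2"
        by (simp add: algebra_simps)
      also have "\<dots> \<le> (1 - a) * (f (x k) - f u) + 4 * a\<^sup>2 * D\<^sup>2 / \<eta> + a\<^sup>2 * C / 2"
        using gradient_loss_le[of a G \<eta> D] a gs(5) assms(9) by (simp add: G_def)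
      also have "\<dots> = (1 - a) * (f (x k) - f u) + a\<^sup>2 * B"
        by (simp add: B_def algebra_simps)
      finally show ?thesis
        by (simp add: a_def)
    qed
    show ?thesis
    proof (intro allI impI)
      fix k :: nat
      assume "1 \<le> k"
      have rate: "f (x k) - 4 * B / (real k + 2) \<le> f u" if "u \<in> T + S" for u
      \<comment> \<open>A competitor outside the sublevel set is worse than every iterate.\<close>
      proof (cases "u \<in> sublevel f x0")
        case True
        have "f (x (Suc (k - 1))) - f u \<le> 4 * B / (real (Suc (k - 1)) + 2)"
          using step[OF True that] \<open>0 \<le> B\<close> by (rule rate_of_recurrence)
        then show ?thesis
          using \<open>1 \<le> k\<close> by simp
      next
        case False
        moreover have "0 \<le> 4 * B / (real k + 2)"
          using \<open>0 \<le> B\<close> by simp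
        ultimately show ?thesis
          using iterates[of k] by (simp add: sublevel_def)
      qed
      have "ereal (f (x k) - 4 * B / (real k + 2)) \<le> opt_value T S f"
        unfolding opt_value_def by (rule INF_greatest) (simp add: rate)
      then have "ereal (f (x k)) - opt_value T S f \<le> ereal (4 * B / (real k + 2))"
        by (cases "opt_value T S f") auto
      also have "\<dots> = (2 * curvature_S T S f x0 + 16 * (diam_T T f x0)\<^sup>2 / ereal \<eta>) /
          ereal (real k + 2)"
        using assms(9) by (simp add: C D B_def algebra_simps)
      finally show "ereal (f (x k)) - opt_value T S f \<le>
          (2 * curvature_S T S f x0 + 16 * (diam_T T f x0)\<^sup>2 / ereal \<eta>) / ereal (real k + 2)" .
    qed
  qed
qed

end
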